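(* Let $|\phi\rangle$ be a unit vector in a finite-dimensional bipartite Hilbert space $\mathcal H^{\rm A}\otimes\mathcal H^{\rm B}$. Then: (i) $M(|\phi\rangle\langle\phi|)=0$ if and only if $|\phi\rangle\langle\phi|$ is a product state, i.e. $|\phi\rangle=|a\rangle\otimes|b\rangle$ for some $|a\rangle\in\mathcal H^{\rm A}$, $|b\rangle\in\mathcal H^{\rm B}$. Thus $M$ never vanishes for an entangled pure state. (ii) $M(|\phi\rangle\langle\phi|)\le S_{\rm vN}({\rm Tr}_{\rm B}|\phi\rangle\langle\phi|)$, where $S_{\rm vN}(\sigma)=-\sum_{k=1}^d\lambda_k\log_2\lambda_k$ is the von Neumann entropy of a $d$-dimensional density matrix $\sigma$ with eigenvalues $\lambda_1,\dots,\lambda_d$ (with multiplicity). (iii) If all Schmidt coefficients of $|\phi\rangle$ are $\le 1/\sqrt2$, then $M(|\phi\rangle\langle\phi|)=S_{\rm vN}({\rm Tr}_{\rm B}|\phi\rangle\langle\phi|)$.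
   Context: A density matrix is a positive semidefinite Hermitian matrix of trace one. The quantity $S_{\rm vN}({\rm Tr}_{\rm B}|\phi\rangle\langle\phi|)$ is the entropy of entanglement of $|\phi\rangle$; $0\log_20=0$. The Schmidt coefficients of $|\phi\rangle$ are the square roots of the nonzero eigenvalues of ${\rm Tr}_{\rm B}|\phi\rangle\langle\phi|$. Definition of $M$ for a density matrix $\rho^{\rm AB}$ on $\mathcal H^{\rm A}\otimes\mathcal H^{\rm B}$. For $x,y\ge0$ let ${\rm nim}_y(x)$ be the nearest integer multiple of $y$ to $x$, ties rounded down: ${\rm nim}_0(x)=0$, and for $y\neq0$, ${\rm nim}_y(x)=y\lfloor x/y\rfloor$ if $x-y\lfloor x/y\rfloor\le y\lceil x/y\rceil-x$, and ${\rm nim}_y(x)=y\lceil x/y\rceil$ otherwise. Let $\eta_1,\dots,\eta_m$ be the distinct eigenvalues of $\rho^{\rm AB}$, let $d^{\eta_j}$ be the dimension of the $\eta_j$-eigenspace, and let $\tilde\rho^{\eta_j}$ be $\eta_j$ times the orthogonal projector onto the $\eta_j$-eigenspace, so $\rho^{\rm AB}=\sum_j\tilde\rho^{\eta_j}$. Let $\lambda_i^{j,{\rm A}}$, $i=1,\dots,d_j^{\rm A}$, be the nonzero eigenvalues, with multiplicity, of ${\rm Tr}_{\rm B}\tilde\rho^{\eta_j}$, where $d_j^{\rm A}$ is its rank (an eigenvalue $\eta_j=0$ contributes an empty sum). Define $$M^{\rm A}(\rho^{\rm AB})=-\sum_{j=1}^m\sum_{i=1}^{d_j^{\rm A}}\left|\lambda_i^{j,{\rm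 A}}-{\rm nim}_{\eta_j}(\lambda_i^{j,{\rm A}})\right|\log_2\frac{\lambda_i^{j,{\rm A}}}{\eta_jd^{\eta_j}}.$$ $M^{\rm B}(\rho^{\rm AB})$ is defined in the same way using the nonzero eigenvalues $\lambda_i^{j,{\rm B}}$ of ${\rm Tr}_{\rm A}\tilde\rho^{\eta_j}$. Finally $M(\rho^{\rm AB})=\frac12[M^{\rm A}(\rho^{\rm AB})+M^{\rm B}(\rho^{\rm AB})]$. *)

theory Defs
  imports "HOL-Analysis.Analysis" "HOL-Library.Multiset"
begin

text \<open>
  The Hilbert spaces are the coordinate spaces \<open>complex ^ 'a\<close> and \<open>complex ^ 'b\<close>, whose norm is the
  Hilbert space norm; their tensor product is \<open>complex ^ ('a \<times> 'b)\<close>.  Operators are square matrices.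
\<close>

subsection \<open>Hermitian matrices, eigenvalues and projectors\<close>

definition conj_transpose :: "complex ^ 'n ^ 'm \<Rightarrow> complex ^ 'm ^ 'n" where
  "conj_transpose A = (\<chi> i j. cnj (A $ j $ i))"

definition hermitian :: "complex ^ 'n ^ 'n \<Rightarrow> bool" where
  "hermitian A \<longleftrightarrow> conj_transpose A = A"

definition eigenspace :: "complex ^ 'n ^ 'n \<Rightarrow> complex \<Rightarrow> (complex ^ 'n) set" where
  "eigenspace A c = {v. A *v v = c *s v}"

text \<open>
  Only Hermitian matrices are relevant below, and their eigenvalues are real
  (\<open>hermitian_eigenvalue_real\<close>), finite in number (\<open>finite_eigenvalues\<close>), and of multiplicity equal
  to the dimension of the eigenspace.  The constant \<open>vec.dim\<close> is the dimension over the complex field.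
\<close>

definition eigenvalues :: "complex ^ 'n ^ 'n \<Rightarrow> real set" where
  "eigenvalues A = {l. \<exists>v. v \<noteq> 0 \<and> v \<in> eigenspace A (of_real l)}"

definition eigenvalue_mset :: "complex ^ 'n ^ 'n \<Rightarrow> real multiset" where
  "eigenvalue_mset A =
     (\<Sum>l\<in>eigenvalues A. replicate_mset (vec.dim (eigenspace A (of_real l))) l)"

definition is_orth_projector :: "complex ^ 'n ^ 'n \<Rightarrow> (complex ^ 'n) set \<Rightarrow> bool" where
  "is_orth_projector P V \<longleftrightarrow> hermitian P \<and> P ** P = P \<and> range (\<lambda>v. P *v v) = V"

text \<open>Well defined for every complex subspace, see \<open>orth_projector\<close>.\<close>

definition orth_projector :: "(complex ^ 'n) set \<Rightarrow> complex ^ 'n ^ 'n" where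
  "orth_projector V = (THE P. is_orth_projector P V)"

definition spectral_part :: "complex ^ 'n ^ 'n \<Rightarrow> real \<Rightarrow> complex ^ 'n ^ 'n" where
  "spectral_part A l = l *\<^sub>R orth_projector (eigenspace A (of_real l))"

subsection \<open>Bipartite systems\<close>

definition ket_bra :: "complex ^ 'n \<Rightarrow> complex ^ 'n ^ 'n" where
  "ket_bra v = (\<chi> i j. v $ i * cnj (v $ j))"

definition tensor_vec :: "complex ^ ('a::finite) \<Rightarrow> complex ^ ('b::finite) \<Rightarrow> complex ^ ('a \<times> 'b)" where
  "tensor_vec a b = (\<chi> p. a $ fst p * b $ snd p)"

definition product_vec :: "complex ^ ('a::finite \<times> 'b::finite) \<Rightarrow> bool" where
  "product_vec v \<longleftrightarrow> (\<exists>a b. v = tensor_vec a b)"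

definition trace_B :: "complex ^ ('a::finite \<times> 'b::finite) ^ ('a::finite \<times> 'b::finite) \<Rightarrow> complex ^ 'a ^ 'a" where
  "trace_B R = (\<chi> i i'. \<Sum>k\<in>UNIV. R $ (i, k) $ (i', k))"

definition trace_A :: "complex ^ ('a::finite \<times> 'b::finite) ^ ('a::finite \<times> 'b::finite) \<Rightarrow> complex ^ 'b ^ 'b" where
  "trace_A R = (\<chi> k k'. \<Sum>i\<in>UNIV. R $ (i, k) $ (i, k'))"

definition schmidt_coefficients :: "complex ^ ('a::finite \<times> 'b::finite) \<Rightarrow> real set" where
  "schmidt_coefficients v = {sqrt l | l. l \<in> eigenvalues (trace_B (ket_bra v)) \<and> l \<noteq> 0}"

text \<open>
  The multiset lists eigenvalues with multiplicity.  A zero eigenvalue contributes 0,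
  because its logarithm is multiplied by 0.
\<close>

definition von_neumann_entropy :: "complex ^ 'n ^ 'n \<Rightarrow> real" where
  "von_neumann_entropy S = - (\<Sum>l\<in>#eigenvalue_mset S. l * log 2 l)"

subsection \<open>The quantity M\<close>

text \<open>
  \<open>M_A\<close>, \<open>M_B\<close> and \<open>M_AB\<close> are meant for density matrices \<open>R\<close>.  The eigenvalue 0 of \<open>R\<close>, if present,
  contributes an empty sum, because its spectral part is the zero matrix.
\<close>

definition nim :: "real \<Rightarrow> real \<Rightarrow> real" where
  "nim y x =
     (if y = 0 then 0
      else if x - y * \<lfloor>x / y\<rfloor> \<le> y * \<lceil>x / y\<rceil> - x then y * \<lfloor>x / y\<rfloor>
      else y * \<lceil>x / y\<rceil>)"

definition M_A :: "complex ^ ('a::finite \<times> 'b::finite) ^ ('a::finite \<times> 'b::finite) \<Rightarrow> real" where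
  "M_A R = - (\<Sum>\<eta>\<in>eigenvalues R.
     \<Sum>l\<in>#{#l \<in># eigenvalue_mset (trace_B (spectral_part R \<eta>)). l \<noteq> 0#}.
       \<bar>l - nim \<eta> l\<bar> * log 2 (l / (\<eta> * real (vec.dim (eigenspace R (of_real \<eta>))))))"

definition M_B :: "complex ^ ('a::finite \<times> 'b::finite) ^ ('a::finite \<times> 'b::finite) \<Rightarrow> real" where
  "M_B R = - (\<Sum>\<eta>\<in>eigenvalues R.
     \<Sum>l\<in>#{#l \<in># eigenvalue_mset (trace_A (spectral_part R \<eta>)). l \<noteq> 0#}.
       \<bar>l - nim \<eta> l\<bar> * log 2 (l / (\<eta> * real (vec.dim (eigenspace R (of_real \<eta>))))))"

definition M_AB :: "complex ^ ('a::finite \<times> 'b::finite) ^ ('a::finite \<times> 'b::finite) \<Rightarrow> real" where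
  "M_AB R = (M_A R + M_B R) / 2"

subsection \<open>Well-definedness\<close>

definition cinner :: "complex ^ 'n \<Rightarrow> complex ^ 'n \<Rightarrow> complex" where
  "cinner x y = (\<Sum>i\<in>UNIV. cnj (x $ i) * y $ i)"

lemma cinner_add_right: "cinner x (y + z) = cinner x y + cinner x z"
  by (simp add: cinner_def algebra_simps sum.distrib)

lemma cinner_diff_right: "cinner x (y - z) = cinner x y - cinner x z"
  by (simp add: cinner_def algebra_simps sum_subtractf)

lemma cinner_scale_right: "cinner x (c *s y) = c * cinner x y"
  by (simp add: cinner_def sum_distrib_left mult_ac)

lemma cinner_scale_left: "cinner (c *s x) y = cnj c * cinner x y"
  by (simp add: cinner_def sum_distrib_left mult_ac)

lemma cinner_commute: "cinner x y = cnj (cinner y x)"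
  by (simp add: cinner_def mult_ac)

lemma Re_cinner: "Re (cinner x y) = x \<bullet> y"
  by (simp add: cinner_def inner_vec_def inner_complex_def)

lemma cinner_self: "cinner x x = of_real ((norm x)\<^sup>2)"
proof (rule complex_eqI)
  show "Im (cinner x x) = Im (of_real ((norm x)\<^sup>2))"
    using arg_cong[OF cinner_commute[of x x], of Im] by (simp del: of_real_power)
qed (simp add: Re_cinner power2_norm_eq_inner del: of_real_power)

lemma cinner_mult_right:
  fixes A :: "complex ^ 'n ^ 'm"
  shows "cinner x (A *v y) = cinner (conj_transpose A *v x) y"
proof -
  have "cinner x (A *v y) = (\<Sum>i\<in>UNIV. \<Sum>j\<in>UNIV. cnj (x $ i) * A $ i $ j * y $ j)"
    by (simp add: cinner_def matrix_vector_mult_def sum_distrib_left mult_ac)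
  also have "\<dots> = (\<Sum>j\<in>UNIV. \<Sum>i\<in>UNIV. cnj (x $ i) * A $ i $ j * y $ j)"
    by (rule sum.swap)
  also have "\<dots> = cinner (conj_transpose A *v x) y"
    by (simp add: cinner_def conj_transpose_def matrix_vector_mult_def sum_distrib_left
        sum_distrib_right mult_ac)
  finally show ?thesis .
qed

lemma hermitian_cinner: "hermitian A \<Longrightarrow> cinner x (A *v y) = cinner (A *v x) y"
  by (simp add: cinner_mult_right hermitian_def)

lemma cinner_axis: "cinner (axis i 1) (A *v axis j 1) = A $ i $ j"
proof -
  have "A *v axis j 1 = column j A"
    by (simp add: vec_eq_iff matrix_vector_mult_def axis_def column_def
        if_distrib[of "\<lambda>x. _ * x"] cong: if_cong)
  then show ?thesis
    by (simp add: cinner_def axis_def column_def if_distrib[of cnj] if_distribR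
        if_distrib[of "\<lambda>x. x * _"] cong: if_cong)
qed

lemma hermitian_iff_cinner: "hermitian A \<longleftrightarrow> (\<forall>x y. cinner x (A *v y) = cinner (A *v x) y)"
proof
  assume r: "\<forall>x y. cinner x (A *v y) = cinner (A *v x) y"
  have "cnj (A $ j $ i) = A $ i $ j" for i j
    using r[rule_format, of "axis i 1" "axis j 1"] cinner_axis[of i A j] cinner_axis[of j A i]
      cinner_commute[of "A *v axis i 1" "axis j 1"] by simp
  then show "hermitian A"
    by (simp add: hermitian_def conj_transpose_def vec_eq_iff)
qed (simp add: hermitian_cinner)

lemma hermitian_eigenvalue_real:
  assumes "hermitian A" "v \<noteq> 0" "v \<in> eigenspace A c"
  shows "c \<in> \<real>"
proof -
  have "A *v v = c *s v"
    using assms by (simp add: eigenspace_def)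
  then have "c * cinner v v = cnj c * cinner v v"
    using hermitian_cinner[OF assms(1), of v v]
    by (simp add: cinner_scale_right cinner_scale_left)
  then have "c = cnj c"
    using assms(2) by (simp add: cinner_self)
  then show ?thesis
    by (simp add: Reals_cnj_iff)
qed

lemma finite_eigenvalues:
  assumes "hermitian A"
  shows "finite (eigenvalues A)"
proof -
  have "\<forall>l\<in>eigenvalues A. \<exists>v. v \<noteq> 0 \<and> A *v v = of_real l *s v"
    by (auto simp: eigenvalues_def eigenspace_def)
  then obtain f where f: "f l \<noteq> 0" "A *v f l = of_real l *s f l" if "l \<in> eigenvalues A" for l
    by metis
  have orth: "f l \<bullet> f m = 0" if "l \<in> eigenvalues A" "m \<in> eigenvalues A" "l \<noteq> m" for l m
  proof -
    have "of_real m * cinner (f l) (f m) = of_real l * cinner (f l) (f m)"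
      using hermitian_cinner[OF assms, of "f l" "f m"] f that
      by (simp add: cinner_scale_right cinner_scale_left)
    then have "cinner (f l) (f m) = 0"
      using that by simp
    then show ?thesis
      using Re_cinner[of "f l" "f m"] by simp
  qed
  have inj: "inj_on f (eigenvalues A)"
    using orth f(1) by (metis inj_onI inner_eq_zero_iff)
  have "pairwise orthogonal (f ` eigenvalues A)"
    using orth by (auto simp: pairwise_def orthogonal_def)
  then have "finite (f ` eigenvalues A)"
    by (rule pairwise_orthogonal_imp_finite)
  then show ?thesis
    using inj finite_imageD by blast
qed

lemma subspace_eigenspace: "vec.subspace (eigenspace A c)"
  by (auto simp: vec.subspace_def eigenspace_def matrix_vector_right_distrib
      vec.scale_right_distrib vector_scalar_commute mult_ac)

lemma is_orth_projector_unique: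
  assumes "is_orth_projector P V" "is_orth_projector Q V"
  shows "P = Q"
proof -
  have fixes_range: "P *v (Q *v x) = Q *v x"
    if P: "is_orth_projector P V" and Q: "is_orth_projector Q V" for P Q x
  proof -
    have "Q *v x \<in> range (\<lambda>v. P *v v)"
      using P Q by (auto simp: is_orth_projector_def)
    then obtain v where v: "Q *v x = P *v v"
      by auto
    have "P *v (P *v v) = P *v v"
      using P by (simp add: is_orth_projector_def matrix_vector_mul_assoc)
    then show ?thesis
      by (simp only: v)
  qed
  have h: "hermitian P" "hermitian Q"
    using assms by (auto simp: is_orth_projector_def)
  have "P $ i $ j = Q $ i $ j" for i j
  proof -
    let ?x = "axis i 1 :: complex ^ 'a" and ?y = "axis j 1 :: complex ^ 'a"
    have "cinner ?x (P *v ?y) = cinner ?x (Q *v (P *v ?y))"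
      using fixes_range[OF assms(2,1)] by simp
    also have "\<dots> = cinner (P *v (Q *v ?x)) ?y"
      by (simp add: hermitian_cinner h)
    also have "\<dots> = cinner ?x (Q *v ?y)"
      using fixes_range[OF assms] by (simp add: hermitian_cinner h)
    finally show ?thesis
      by (simp add: cinner_axis)
  qed
  then show ?thesis
    by (simp add: vec_eq_iff)
qed

lemma is_orth_projector_exists:
  fixes V :: "(complex ^ 'n) set"
  assumes V: "vec.subspace V"
  shows "\<exists>P. is_orth_projector P V"
proof -
  have scaleR: "r *\<^sub>R x = of_real r *s x" for r and x :: "complex ^ 'n"
    by (simp add: vec_eq_iff scaleR_conv_of_real[where 'a=complex])
  have real_V: "subspace V"
    using V by (auto simp: subspace_def vec.subspace_def scaleR)
  have "\<exists>y. y \<in> V \<and> (\<forall>w\<in>V. cinner w (x - y) = 0)" for x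
  proof -
    obtain y z where yz: "y \<in> span V" "\<And>w. w \<in> span V \<Longrightarrow> orthogonal z w" "x = y + z"
      using orthogonal_subspace_decomp_exists[of V x] by blast
    have y: "y \<in> V"
      using yz(1) real_V by (simp add: span_eq_iff[THEN iffD2])
    have re: "Re (cinner w z) = 0" if "w \<in> V" for w
      using yz(2)[OF span_base[OF that]]
      by (simp add: Re_cinner orthogonal_def inner_commute)
    have "cinner w z = 0" if w: "w \<in> V" for w
    proof (rule complex_eqI)
      have "\<i> *s w \<in> V"
        using V w by (simp add: vec.subspace_def)
      then have "Re (cinner (\<i> *s w) z) = 0"
        by (rule re)
      then show "Im (cinner w z) = Im 0"
        by (simp add: cinner_scale_left)
    qed (simp add: re w)
    then show ?thesis
      using y yz(3) by (intro exI[of _ y]) auto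
  qed
  then obtain f where fV: "f x \<in> V" and fo: "w \<in> V \<Longrightarrow> cinner w (x - f x) = 0" for x w
    by metis
  have f_eq: "f x = y" if "y \<in> V" "\<And>w. w \<in> V \<Longrightarrow> cinner w (x - y) = 0" for x y
  proof -
    have d: "y - f x \<in> V"
      using V fV that(1) by (simp add: vec.subspace_diff)
    have "cinner (y - f x) ((x - f x) - (x - y)) = 0"
      using fo[OF d, of x] that(2)[OF d] by (simp add: cinner_diff_right)
    then show ?thesis
      by (simp add: cinner_self)
  qed
  have lin: "Vector_Spaces.linear (*s) (*s) f"
    unfolding Vector_Spaces.linear_iff
  proof (intro conjI allI vec.vector_space_axioms)
    show "f (x + y) = f x + f y" for x y
    proof (rule f_eq)
      show "cinner w (x + y - (f x + f y)) = 0" if "w \<in> V" for w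
        using fo[OF that, of x] fo[OF that, of y]
        by (simp add: cinner_diff_right cinner_add_right)
    qed (use V fV in \<open>simp add: vec.subspace_def\<close>)
    show "f (c *s x) = c *s f x" for c x
    proof (rule f_eq)
      show "cinner w (c *s x - c *s f x) = 0" if "w \<in> V" for w
        using fo[OF that, of x]
        by (simp add: cinner_diff_right cinner_scale_right)
    qed (use V fV in \<open>simp add: vec.subspace_def\<close>)
  qed
  have mat: "matrix f *v x = f x" for x
    using matrix_works[OF lin] by simp
  have f_V: "f x = x" if "x \<in> V" for x
    using that by (intro f_eq) (auto simp: cinner_def)
  have proj: "cinner (f x) y = cinner (f x) (f y)" for x y
    using fo[OF fV, of x y] by (simp add: cinner_diff_right)
  have "hermitian (matrix f)"
    unfolding hermitian_iff_cinner mat by (metis cinner_commute proj)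
  moreover have "matrix f ** matrix f = matrix f"
    by (simp add: matrix_eq matrix_vector_mul_assoc[symmetric] mat f_V fV)
  moreover have "range (\<lambda>v. matrix f *v v) = V"
    unfolding mat using fV f_V by (auto simp: image_iff) metis
  ultimately show ?thesis
    by (auto simp: is_orth_projector_def)
qed

lemma orth_projector:
  assumes "vec.subspace V"
  shows "is_orth_projector (orth_projector V) V"
  unfolding orth_projector_def
  by (rule theI') (use is_orth_projector_exists[OF assms] is_orth_projector_unique in blast)

lemma hermitian_ket_bra: "hermitian (ket_bra v)"
  by (simp add: hermitian_def conj_transpose_def ket_bra_def vec_eq_iff mult_ac)

lemma hermitian_spectral_part: "hermitian (spectral_part A l)"
proof -
  have "hermitian (orth_projector (eigenspace A (of_real l)))"
    using orth_projector[OF subspace_eigenspace] by (auto simp: is_orth_projector_def)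
  then show ?thesis
    by (simp add: spectral_part_def hermitian_def conj_transpose_def vec_eq_iff)
qed

lemma hermitian_trace_B: "hermitian R \<Longrightarrow> hermitian (trace_B R)"
  by (simp add: hermitian_def conj_transpose_def trace_B_def vec_eq_iff)

lemma hermitian_trace_A: "hermitian R \<Longrightarrow> hermitian (trace_A R)"
  by (simp add: hermitian_def conj_transpose_def trace_A_def vec_eq_iff)

end

theory Submission
  imports Defs
begin

text \<open>
  The only nonzero eigenvalue of a pure state is 1, with one-dimensional eigenspace, so \<open>M_A\<close> and
  \<open>M_B\<close> are sums of \<open>- min l (1 - l) * log 2 l\<close> over the nonzero eigenvalues \<open>l\<close> of the two reduced
  states. Their nonzero spectra agree with multiplicity, because contraction with the state vector is an
  antilinear bijection between the eigenspaces, and lie in \<open>{0<..1}\<close>. Comparing with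
  \<open>- l * log 2 l\<close> term by term gives the inequality, and equality if all \<open>l \<le> 1 / 2\<close>.
  The sum vanishes only if some (hence every) nonzero eigenvalue is 1; contraction with a corresponding
  unit eigenvector then preserves the norm, which forces the vector to be a product.
\<close>

subsection \<open>Spectra of Hermitian matrices\<close>

lemma scaleR_eq_scale: "r *\<^sub>R x = of_real r *s (x :: complex ^ 'n)"
  by (simp add: vec_eq_iff scaleR_conv_of_real[where 'a=complex])

lemma matrix_vector_mult_scale:
  fixes A :: "complex ^ 'n ^ 'm"
  shows "A *v (c *s x) = c *s (A *v x)"
  by (simp add: vec_eq_iff matrix_vector_mult_def sum_distrib_left mult_ac)

lemma hermitian_inner:
  assumes "hermitian A"
  shows "x \<bullet> (A *v y) = (A *v x) \<bullet> y"
  using hermitian_cinner[OF assms, of x y] by (metis Re_cinner)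

text \<open>First-order condition at a minimum: the quadratic is 0 at \<open>t = 0\<close> and never
  smaller, so its slope there vanishes.\<close>

lemma linear_part_zero_if_quadratic_nonneg:
  fixes b c :: real
  assumes "\<And>t. 0 \<le> 2 * t * b + t\<^sup>2 * c"
  shows "b = 0"
proof (rule ccontr)
  assume b: "b \<noteq> 0"
  define d where "d = \<bar>c\<bar> + 1"
  have d: "d > 0" "c < d" "c \<le> d"
    by (auto simp: d_def)
  \<comment> \<open>A small step against the slope: \<open>d\<close> is positive and bounds
    \<open>c\<close>, so the quadratic term recovers at most half of the linear decrease.\<close>
  have "0 \<le> 2 * (- b / d) * b + (- b / d)\<^sup>2 * c"
    by (rule assms)
  also have "\<dots> \<le> 2 * (- b / d) * b + (- b / d)\<^sup>2 * d"
    using d by (intro add_left_mono mult_left_mono) auto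
  also have "\<dots> = - (b\<^sup>2 / d)"
    using d by (simp add: field_simps power2_eq_square)
  also have "\<dots> < 0"
    using d b by simp
  finally show False
    by simp
qed

text \<open>
  The maximum of the Rayleigh quotient is attained at an eigenvector: the form
  \<open>l \<parallel>x\<parallel>\<^sup>2 - x \<bullet> A x\<close> is nonnegative and vanishes at the maximiser, so its derivative vanishes there.
\<close>

lemma hermitian_max_eigenvalue:
  fixes A :: "complex ^ 'n ^ 'n"
  assumes A: "hermitian A"
  obtains l where "l \<in> eigenvalues A" "\<And>x. x \<bullet> (A *v x) \<le> l * (norm x)\<^sup>2"
proof -
  let ?q = "\<lambda>x. x \<bullet> (A *v x)"
  have "continuous_on (sphere 0 1) ?q"
    by (intro continuous_intros linear_continuous_on) auto
  moreover have "axis undefined 1 \<in> sphere (0 :: complex ^ 'n) 1"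
    by simp
  then have "sphere (0 :: complex ^ 'n) 1 \<noteq> {}"
    by blast
  ultimately obtain u :: "complex ^ 'n" where u: "norm u = 1"
    and max: "\<And>x. norm x = 1 \<Longrightarrow> ?q x \<le> ?q u"
    using continuous_attains_sup[of "sphere 0 1" ?q] by auto
  define l where "l = ?q u"
  have scale: "A *v (r *\<^sub>R x) = r *\<^sub>R (A *v x)" for r x
    by (simp add: scaleR_eq_scale matrix_vector_mult_scale)
  \<comment> \<open>The bound on the unit sphere extends to all vectors by homogeneity.\<close>
  have le: "?q x \<le> l * (norm x)\<^sup>2" for x
  proof (cases "x = 0")
    case False
    then have "?q (x /\<^sub>R norm x) \<le> l"
      unfolding l_def by (intro max) simp
    with False show ?thesis
      by (simp add: scale field_simps power2_eq_square)
  qed simp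
  have orth: "(l *\<^sub>R u - A *v u) \<bullet> v = 0" for v
  proof (rule linear_part_zero_if_quadratic_nonneg)
    fix t :: real
    let ?x = "u + t *\<^sub>R v"
    have "0 \<le> l * (?x \<bullet> ?x) - ?q ?x"
      using le[of ?x] by (simp add: power2_norm_eq_inner)
    \<comment> \<open>Hermiticity makes the two cross terms equal, which gives the factor 2.\<close>
    also have "\<dots> = (l * (u \<bullet> u) - ?q u) + 2 * t * ((l *\<^sub>R u - A *v u) \<bullet> v)
        + t\<^sup>2 * (l * (v \<bullet> v) - ?q v)"
      using hermitian_inner[OF A, of u v]
      by (simp add: matrix_vector_right_distrib scale inner_commute
          inner_add_left inner_add_right inner_diff_left algebra_simps power2_eq_square)
    also have "l * (u \<bullet> u) - ?q u = 0"
      using u by (simp add: l_def norm_eq_1)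
    finally show "0 \<le> 2 * t * ((l *\<^sub>R u - A *v u) \<bullet> v) + t\<^sup>2 * (l * (v \<bullet> v) - ?q v)"
      by simp
  qed
  have "A *v u = of_real l *s u"
    using orth[of "l *\<^sub>R u - A *v u"] by (simp add: scaleR_eq_scale)
  then have "l \<in> eigenvalues A"
    using u unfolding eigenvalues_def eigenspace_def by (auto intro!: exI[of _ u])
  then show thesis
    using le by (rule that)
qed

section \<open>Sums over eigenvalues with multiplicity\<close>

lemma filter_mset_replicate_mset:
  "{#x \<in># replicate_mset n a. P x#} = (if P a then replicate_mset n a else {#})"
  by (induction n) auto

lemma sum_mset_replicate:
  "(\<Sum>x\<in>#replicate_mset n a. f x) = of_nat n * (f a :: real)"
  by (induction n) (auto simp: algebra_simps)

text \<open>Trades multiset sums for finite sums weighted by eigenspace dimensions; Hermiticity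
  supplies finiteness of the spectrum.\<close>

lemma sum_eigenvalue_mset_nonzero:
  assumes "hermitian S"
  shows "(\<Sum>l\<in>#{#l \<in># eigenvalue_mset S. l \<noteq> 0#}. f l) =
    (\<Sum>l\<in>eigenvalues S - {0}. real (vec.dim (eigenspace S (of_real l))) * f l)"
proof -
  let ?d = "\<lambda>l. vec.dim (eigenspace S (of_real l))"
  have filter: "{#l \<in># (\<Sum>l\<in>X. replicate_mset (?d l) l). l \<noteq> 0#}
      = (\<Sum>l\<in>X - {0}. replicate_mset (?d l) l)" if "finite X" for X
    using that
  proof (induction X)
    case (insert x X)
    then show ?case
      by (cases "x = 0") (auto simp: insert_Diff_if filter_mset_replicate_mset)
  qed simp
  have sum: "(\<Sum>l\<in>#(\<Sum>l\<in>X. replicate_mset (?d l) l). f l) = (\<Sum>l\<in>X. real (?d l) * f l)"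
    if "finite X" for X
    using that by (induction X) (simp_all add: sum_mset_replicate)
  show ?thesis
    using finite_eigenvalues[OF assms] by (simp add: eigenvalue_mset_def filter sum)
qed

lemma von_neumann_entropy_eq:
  assumes "hermitian S"
  shows "von_neumann_entropy S =
    - (\<Sum>l\<in>eigenvalues S - {0}. real (vec.dim (eigenspace S (of_real l))) * (l * log 2 l))"
proof -
  have "(\<Sum>l\<in>#X. l * log 2 l) = (\<Sum>l\<in>#{#l \<in># X. l \<noteq> 0#}. l * log 2 l)"
    for X :: "real multiset"
    by (induction X) auto
  from this[of "eigenvalue_mset S"] show ?thesis
    by (simp only: von_neumann_entropy_def sum_eigenvalue_mset_nonzero[OF assms])
qed

text \<open>Lets an equality of eigenspace dimensions yield an equality of spectra.\<close>

lemma eigenvalue_iff_dim: "l \<in> eigenvalues S \<longleftrightarrow> vec.dim (eigenspace S (of_real l)) > 0"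
proof -
  have "l \<in> eigenvalues S \<longleftrightarrow> \<not> eigenspace S (of_real l) \<subseteq> {0}"
    unfolding eigenvalues_def by blast
  also have "\<dots> \<longleftrightarrow> vec.dim (eigenspace S (of_real l)) > 0"
    unfolding vec.dim_eq_0[symmetric] by (rule neq0_conv)
  finally show ?thesis .
qed

lemma dim_antilinear_image_le:
  fixes f :: "complex ^ 'n \<Rightarrow> complex ^ 'm"
  assumes add: "\<And>x y. f (x + y) = f x + f y" and scale: "\<And>c x. f (c *s x) = cnj c *s f x"
    and sub: "W \<subseteq> f ` V"
  shows "vec.dim W \<le> vec.dim V"
proof -
  obtain B where B: "B \<subseteq> V" "vec.independent B" "V \<subseteq> vec.span B" "card B = vec.dim V"
    using vec.basis_exists[of V] by blast
  have fin: "finite B"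
    using B(2) by (rule vec.finiteI_independent)
  have "f x \<in> vec.span (f ` B)" if "x \<in> vec.span B" for x
    using that
  proof (induction rule: vec.span_induct_alt)
    case base
    have "f 0 = 0"
      using scale[of 0 0] by simp
    then show ?case
      by (simp add: vec.span_zero)
  next
    case (step c x y)
    then show ?case
      by (simp add: add scale vec.span_add vec.span_scale vec.span_base)
  qed
  then have "W \<subseteq> vec.span (f ` B)"
    using sub B(3) by blast
  then have "vec.dim W \<le> card (f ` B)"
    using fin by (intro vec.dim_le_card) auto
  also have "\<dots> \<le> vec.dim V"
    using card_image_le[OF fin, of f] B(4) by simp
  finally show ?thesis .
qed

subsection \<open>Reduced states of a pure state\<close>

text \<open>Exchanging the tensor factors turns \<open>trace_A\<close> into \<open>trace_B\<close>,
  so only one reduced state has to be analysed.\<close>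

definition swap_vec :: "complex ^ ('a::finite \<times> 'b::finite) \<Rightarrow> complex ^ ('b \<times> 'a)" where
  "swap_vec v = (\<chi> p. v $ prod.swap p)"

lemma swap_swap_vec [simp]: "swap_vec (swap_vec v) = v"
  by (simp add: swap_vec_def vec_eq_iff)

lemma trace_A_ket_bra: "trace_A (ket_bra v) = trace_B (ket_bra (swap_vec v))"
  by (simp add: trace_A_def trace_B_def ket_bra_def swap_vec_def)

lemma swap_tensor_vec: "swap_vec (tensor_vec a b) = tensor_vec b a"
  by (simp add: swap_vec_def tensor_vec_def vec_eq_iff mult.commute)

section \<open>Contraction of a bipartite vector with a vector of one factor\<close>

lemma sum_UNIV_prod:
  "(\<Sum>p\<in>UNIV. f p) = (\<Sum>i\<in>(UNIV::'a::finite set). \<Sum>k\<in>(UNIV::'b::finite set). f (i, k))"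
  by (simp add: sum.cartesian_product)

text \<open>The bra of \<open>u\<close> applied to the first factor of \<open>v\<close>; antilinear
  in \<open>u\<close>.\<close>

definition partial_inner ::
    "complex ^ ('a::finite \<times> 'b::finite) \<Rightarrow> complex ^ 'a \<Rightarrow> complex ^ 'b" where
  "partial_inner v u = (\<chi> k. \<Sum>i\<in>UNIV. cnj (u $ i) * v $ (i, k))"

lemma partial_inner_add: "partial_inner v (x + y) = partial_inner v x + partial_inner v y"
  by (simp add: partial_inner_def vec_eq_iff algebra_simps sum.distrib)

lemma partial_inner_scale: "partial_inner v (c *s x) = cnj c *s partial_inner v x"
  by (simp add: partial_inner_def vec_eq_iff sum_distrib_left mult_ac)

lemma cinner_tensor_vec_left: "cinner (tensor_vec u w) v = cinner w (partial_inner v u)"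
proof -
  have "cinner (tensor_vec u w) v
      = (\<Sum>i\<in>UNIV. \<Sum>k\<in>UNIV. cnj (u $ i) * cnj (w $ k) * v $ (i, k))"
    by (simp add: cinner_def tensor_vec_def sum_UNIV_prod)
  also have "\<dots> = (\<Sum>k\<in>UNIV. \<Sum>i\<in>UNIV. cnj (u $ i) * cnj (w $ k) * v $ (i, k))"
    by (rule sum.swap)
  also have "\<dots> = cinner w (partial_inner v u)"
    by (simp add: cinner_def partial_inner_def sum_distrib_left mult_ac)
  finally show ?thesis .
qed

lemma cinner_swap_vec: "cinner (swap_vec x) (swap_vec y) = cinner x y"
proof -
  have "cinner (swap_vec x) (swap_vec y)
      = (\<Sum>k\<in>UNIV. \<Sum>i\<in>UNIV. cnj (x $ (i, k)) * y $ (i, k))"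
    by (simp add: cinner_def swap_vec_def sum_UNIV_prod)
  also have "\<dots> = (\<Sum>i\<in>UNIV. \<Sum>k\<in>UNIV. cnj (x $ (i, k)) * y $ (i, k))"
    by (rule sum.swap)
  finally show ?thesis
    by (simp add: cinner_def sum_UNIV_prod)
qed

lemma norm_swap_vec [simp]: "norm (swap_vec v) = norm v"
proof -
  have "(norm (swap_vec v))\<^sup>2 = (norm v)\<^sup>2"
    using cinner_swap_vec[of v v] by (simp add: cinner_self flip: of_real_power)
  then show ?thesis
    by simp
qed

text \<open>Both sides are the inner product of \<open>tensor_vec u w\<close> with \<open>v\<close>:
  the two contractions are antilinear adjoints.\<close>

lemma cinner_partial_inner_swap:
  "cinner u (partial_inner (swap_vec v) w) = cinner w (partial_inner v u)"
  by (metis cinner_swap_vec cinner_tensor_vec_left swap_tensor_vec)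

lemma partial_inner_tensor_vec: "partial_inner (tensor_vec a b) u = cinner u a *s b"
  by (simp add: partial_inner_def tensor_vec_def cinner_def vec_eq_iff sum_distrib_left mult_ac)

lemma norm_tensor_vec: "norm (tensor_vec a b) = norm a * norm b"
proof -
  have "cinner (tensor_vec a b) (tensor_vec a b) = cinner a a * cinner b b"
    by (simp add: cinner_tensor_vec_left partial_inner_tensor_vec cinner_scale_right)
  then have "(norm (tensor_vec a b))\<^sup>2 = (norm a * norm b)\<^sup>2"
    by (simp add: cinner_self power_mult_distrib flip: of_real_power of_real_mult)
  then show ?thesis
    by (simp add: power2_eq_iff_nonneg)
qed

text \<open>This factorization into two contractions gives positivity of the reduced state and the
  comparison of the two spectra.\<close>

lemma trace_B_ket_bra_mult:
  "trace_B (ket_bra v) *v u = partial_inner (swap_vec v) (partial_inner v u)"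
proof -
  have "(\<Sum>j\<in>UNIV. (\<Sum>k\<in>UNIV. v $ (i, k) * cnj (v $ (j, k))) * u $ j)
      = (\<Sum>k\<in>UNIV. \<Sum>j\<in>UNIV. v $ (i, k) * cnj (v $ (j, k)) * u $ j)" for i
    unfolding sum_distrib_right by (rule sum.swap)
  then show ?thesis
    by (simp add: vec_eq_iff matrix_vector_mult_def trace_B_def ket_bra_def partial_inner_def
        swap_vec_def sum_distrib_left mult_ac)
qed

lemma hermitian_reduced: "hermitian (trace_B (ket_bra v))"
  by (intro hermitian_trace_B hermitian_ket_bra)

lemma cinner_trace_B_ket_bra:
  "cinner u (trace_B (ket_bra v) *v u) = of_real ((norm (partial_inner v u))\<^sup>2)"
  by (simp add: trace_B_ket_bra_mult cinner_partial_inner_swap cinner_self)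

text \<open>Pythagoras: the subtracted tensor is the orthogonal projection of \<open>v\<close> onto
  the vectors with first factor \<open>u\<close>.\<close>

lemma norm_diff_tensor_partial_inner:
  assumes "norm u = 1"
  shows "(norm (v - tensor_vec u (partial_inner v u)))\<^sup>2 = (norm v)\<^sup>2 - (norm (partial_inner v u))\<^sup>2"
proof -
  let ?t = "tensor_vec u (partial_inner v u)"
  have "?t \<bullet> v = (norm (partial_inner v u))\<^sup>2"
    unfolding Re_cinner[symmetric] cinner_tensor_vec_left cinner_self by simp
  moreover have "(norm ?t)\<^sup>2 = (norm (partial_inner v u))\<^sup>2"
    by (simp add: norm_tensor_vec assms)
  ultimately show ?thesis
    by (simp add: power2_norm_eq_inner inner_diff_left inner_diff_right inner_commute)
qed

section \<open>Nonzero eigenvalues of the reduced states\<close>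

lemma eigenvalues_reducedE:
  assumes "l \<in> eigenvalues (trace_B (ket_bra v))"
  obtains u where "norm u = 1" "trace_B (ket_bra v) *v u = of_real l *s u"
    "l = (norm (partial_inner v u))\<^sup>2"
proof -
  let ?S = "trace_B (ket_bra v)"
  obtain x where x: "x \<noteq> 0" "?S *v x = of_real l *s x"
    using assms by (auto simp: eigenvalues_def eigenspace_def)
  define u where "u = of_real (inverse (norm x)) *s x"
  have u: "norm u = 1"
    unfolding u_def scaleR_eq_scale[symmetric] using x by simp
  have Su: "?S *v u = of_real l *s u"
    by (simp add: u_def matrix_vector_mult_scale x mult.commute)
  have "of_real l = cinner u (?S *v u)"
    using u by (simp add: Su cinner_scale_right cinner_self)
  then have "l = (norm (partial_inner v u))\<^sup>2"
    unfolding cinner_trace_B_ket_bra of_real_eq_iff .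
  with u Su show thesis
    by (rule that)
qed

lemma eigenvalues_reduced_nonneg:
  "l \<in> eigenvalues (trace_B (ket_bra v)) \<Longrightarrow> 0 \<le> l"
  by (erule eigenvalues_reducedE) simp

lemma eigenvalues_reduced_le:
  assumes "l \<in> eigenvalues (trace_B (ket_bra v))"
  shows "l \<le> (norm v)\<^sup>2"
  using assms
proof (rule eigenvalues_reducedE)
  fix u assume "norm u = 1" "l = (norm (partial_inner v u))\<^sup>2"
  then show ?thesis
    using norm_diff_tensor_partial_inner[of u v]
      zero_le_power2[of "norm (v - tensor_vec u (partial_inner v u))"] by linarith
qed

lemma product_vec_if_eigenvalue_1:
  assumes "norm v = 1" "1 \<in> eigenvalues (trace_B (ket_bra v))"
  shows "product_vec v"
  using assms(2)
proof (rule eigenvalues_reducedE)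
  fix u assume "norm u = 1" "1 = (norm (partial_inner v u))\<^sup>2"
  then have "v = tensor_vec u (partial_inner v u)"
    using norm_diff_tensor_partial_inner[of u v] assms(1) by simp
  then show ?thesis
    unfolding product_vec_def by blast
qed

lemma eigenvalues_reduced_product:
  assumes "norm (tensor_vec a b) = 1" "l \<in> eigenvalues (trace_B (ket_bra (tensor_vec a b)))" "l \<noteq> 0"
  shows "l = 1"
  using assms(2)
proof (rule eigenvalues_reducedE)
  fix u
  assume u: "norm u = 1" "trace_B (ket_bra (tensor_vec a b)) *v u = of_real l *s u"
  have nz: "norm a * norm b = 1"
    using assms(1) by (simp add: norm_tensor_vec)
  \<comment> \<open>The reduced state of a product maps everything to multiples of \<open>a\<close>;
    pairing with \<open>a\<close> then isolates \<open>l\<close>.\<close>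
  have eq: "of_real l *s u = (cinner a u * cinner b b) *s a"
    using u(2) cinner_commute[of a u]
    by (simp add: trace_B_ket_bra_mult partial_inner_tensor_vec swap_tensor_vec partial_inner_scale)
  have "of_real l * cinner a u = cinner a u * cinner b b * cinner a a"
    using arg_cong[OF eq, of "cinner a"] by (simp add: cinner_scale_right)
  also have "\<dots> = cinner a u * of_real ((norm a * norm b)\<^sup>2)"
    by (simp add: cinner_self power_mult_distrib)
  finally have "of_real l * cinner a u = cinner a u"
    by (simp add: nz)
  \<comment> \<open>Otherwise \<open>eq\<close> would make the nonzero vector \<open>l u\<close>
    vanish.\<close>
  moreover have "cinner a u \<noteq> 0"
    using eq u(1) assms(3) by auto
  ultimately show ?thesis
    by simp
qed

text \<open>The largest eigenvalue dominates every expectation value, and some basis vector has a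
  positive one.\<close>

lemma reduced_nonzero_eigenvalue:
  assumes "v \<noteq> 0"
  obtains l where "l \<in> eigenvalues (trace_B (ket_bra v))" "l \<noteq> 0"
proof -
  let ?S = "trace_B (ket_bra v)"
  obtain l where l: "l \<in> eigenvalues ?S" "\<And>x. x \<bullet> (?S *v x) \<le> l * (norm x)\<^sup>2"
    using hermitian_max_eigenvalue[OF hermitian_reduced] by blast
  obtain i k where ik: "v $ (i, k) \<noteq> 0"
    using assms by (auto simp: vec_eq_iff)
  have "partial_inner v (axis i 1) $ k = v $ (i, k)"
    by (simp add: partial_inner_def axis_def if_distrib[of cnj] if_distribR
        if_distrib[of "\<lambda>x. x * _"] cong: if_cong)
  with ik have "partial_inner v (axis i 1) \<noteq> 0"
    by auto
  then have "0 < axis i 1 \<bullet> (?S *v axis i 1)"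
    unfolding Re_cinner[symmetric] cinner_trace_B_ket_bra by simp
  with l(2)[of "axis i 1"] have "l \<noteq> 0"
    by auto
  with l(1) show thesis
    by (rule that)
qed

text \<open>As for the products GH and HG of two maps, contraction carries one eigenspace onto the
  other when \<open>l\<close> is nonzero.\<close>

lemma dim_eigenspace_swap_le:
  assumes "l \<noteq> 0"
  shows "vec.dim (eigenspace (trace_B (ket_bra (swap_vec v))) (of_real l))
    \<le> vec.dim (eigenspace (trace_B (ket_bra v)) (of_real l))"
proof (rule dim_antilinear_image_le[of "partial_inner v"])
  let ?g = "partial_inner v" and ?h = "partial_inner (swap_vec v)"
  show "eigenspace (trace_B (ket_bra (swap_vec v))) (of_real l)
      \<subseteq> ?g ` eigenspace (trace_B (ket_bra v)) (of_real l)"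
  proof
    fix w assume "w \<in> eigenspace (trace_B (ket_bra (swap_vec v))) (of_real l)"
    then have w: "?g (?h w) = of_real l *s w"
      by (simp add: eigenspace_def trace_B_ket_bra_mult)
    \<comment> \<open>The preimage comes from contracting back and dividing by \<open>l\<close>; the
      scalar is real, so conjugation leaves it alone.\<close>
    let ?u = "of_real (inverse l) *s ?h w"
    have g: "?g ?u = w"
      using assms by (simp add: partial_inner_scale w flip: of_real_mult)
    have "?h w = of_real l *s ?u"
      using assms by (simp flip: of_real_mult)
    then have "?u \<in> eigenspace (trace_B (ket_bra v)) (of_real l)"
      by (simp only: eigenspace_def mem_Collect_eq trace_B_ket_bra_mult g)
    then show "w \<in> ?g ` eigenspace (trace_B (ket_bra v)) (of_real l)"
      using g by (metis imageI)
  qed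
qed (simp_all add: partial_inner_add partial_inner_scale)

lemma dim_eigenspace_swap:
  assumes "l \<noteq> 0"
  shows "vec.dim (eigenspace (trace_B (ket_bra (swap_vec v))) (of_real l))
    = vec.dim (eigenspace (trace_B (ket_bra v)) (of_real l))"
  using dim_eigenspace_swap_le[OF assms, of v] dim_eigenspace_swap_le[OF assms, of "swap_vec v"]
  by simp

text \<open>Zero is removed because its multiplicity depends on the dimensions of the
  factors.\<close>

lemma eigenvalues_swap:
  "eigenvalues (trace_B (ket_bra (swap_vec v))) - {0} = eigenvalues (trace_B (ket_bra v)) - {0}"
  by (auto simp: eigenvalue_iff_dim dim_eigenspace_swap)

subsection \<open>The quantity M for a pure state\<close>

lemma ket_bra_mult: "ket_bra v *v x = cinner v x *s v"
  by (simp add: ket_bra_def matrix_vector_mult_def cinner_def vec_eq_iff sum_distrib_left mult_ac)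

context
  fixes v :: "complex ^ 'n"
  assumes v: "norm v = 1"
begin

lemma cinner_unit_self: "cinner v v = 1"
  using v by (simp add: cinner_self)

lemma eigenspace_ket_bra_1: "eigenspace (ket_bra v) 1 = vec.span {v}"
proof -
  have "x \<in> eigenspace (ket_bra v) 1 \<longleftrightarrow> (\<exists>k. x = k *s v)" for x
  proof
    assume "x \<in> eigenspace (ket_bra v) 1"
    then have "x = cinner v x *s v"
      by (simp add: eigenspace_def ket_bra_mult)
    then show "\<exists>k. x = k *s v"
      by (rule exI)
  qed (auto simp: eigenspace_def ket_bra_mult cinner_scale_right cinner_unit_self)
  then show ?thesis
    by (auto simp: vec.span_singleton)
qed

lemma orth_projector_ket_bra: "orth_projector (eigenspace (ket_bra v) 1) = ket_bra v"
proof (rule is_orth_projector_unique)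
  have "ket_bra v ** ket_bra v = ket_bra v"
    by (simp add: matrix_eq matrix_vector_mul_assoc[symmetric] ket_bra_mult
        cinner_scale_right cinner_unit_self)
  moreover have "range (\<lambda>x. ket_bra v *v x) = eigenspace (ket_bra v) 1"
    unfolding eigenspace_ket_bra_1 vec.span_singleton
  proof (intro subset_antisym subsetI)
    fix x assume "x \<in> range (\<lambda>k. k *s v)"
    then obtain k where "x = k *s v"
      by blast
    then have "x = ket_bra v *v (k *s v)"
      by (simp add: ket_bra_mult cinner_scale_right cinner_unit_self)
    then show "x \<in> range (\<lambda>x. ket_bra v *v x)"
      by (rule range_eqI)
  qed (auto simp: ket_bra_mult)
  ultimately show "is_orth_projector (ket_bra v) (eigenspace (ket_bra v) 1)"
    by (simp add: is_orth_projector_def hermitian_ket_bra)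
qed (rule orth_projector[OF subspace_eigenspace])

lemma spectral_part_ket_bra: "spectral_part (ket_bra v) 1 = ket_bra v"
  by (simp add: spectral_part_def orth_projector_ket_bra)

lemma dim_eigenspace_ket_bra: "vec.dim (eigenspace (ket_bra v) 1) = 1"
proof -
  have "v \<noteq> 0"
    using v by auto
  then show ?thesis
    using vec.dim_eq_card_independent[of "{v}"] by (simp add: eigenspace_ket_bra_1)
qed

lemma one_eigenvalue_ket_bra: "1 \<in> eigenvalues (ket_bra v)"
  by (simp add: eigenvalue_iff_dim dim_eigenspace_ket_bra)

text \<open>Pairing the eigenvalue equation with \<open>v\<close> forces \<open>l = 1\<close> unless
  the eigenvector is orthogonal to \<open>v\<close>, and then \<open>l = 0\<close>.\<close>

lemma eigenvalues_ket_bra: "eigenvalues (ket_bra v) \<subseteq> {0, 1}"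
proof
  fix l assume "l \<in> eigenvalues (ket_bra v)"
  then obtain x where x: "x \<noteq> 0" "cinner v x *s v = of_real l *s x"
    by (auto simp: eigenvalues_def eigenspace_def ket_bra_mult)
  have "cinner v x = of_real l * cinner v x"
    using arg_cong[OF x(2), of "cinner v"] by (simp add: cinner_scale_right cinner_unit_self)
  then show "l \<in> {0, 1}"
    using x by (cases "cinner v x = 0") auto
qed

end

text \<open>In dimension one, 0 is not an eigenvalue; \<open>F 0 = 0\<close> covers both
  situations.\<close>

lemma sum_eigenvalues_ket_bra:
  fixes v :: "complex ^ 'n"
  assumes "norm v = 1" "F 0 = (0 :: real)"
  shows "(\<Sum>\<eta>\<in>eigenvalues (ket_bra v). F \<eta>) = F 1"
proof -
  have "(\<Sum>\<eta>\<in>eigenvalues (ket_bra v). F \<eta>) = (\<Sum>\<eta>\<in>{1}. F \<eta>)"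
    using eigenvalues_ket_bra[OF assms(1)] one_eigenvalue_ket_bra[OF assms(1)] assms(2)
    by (intro sum.mono_neutral_right finite_eigenvalues hermitian_ket_bra) auto
  then show ?thesis
    by simp
qed

section \<open>Reduction of M to the spectrum of one reduced state\<close>

lemma nonzero_eigenvalues_0:
  "{#l \<in># eigenvalue_mset (0 :: complex ^ 'n ^ 'n). l \<noteq> 0#} = {#}"
proof -
  have "eigenvalues (0 :: complex ^ 'n ^ 'n) \<subseteq> {0}"
    by (auto simp: eigenvalues_def eigenspace_def)
  then consider "eigenvalues (0 :: complex ^ 'n ^ 'n) = {}" | "eigenvalues (0 :: complex ^ 'n ^ 'n) = {0}"
    by blast
  then show ?thesis
    by cases (simp_all add: eigenvalue_mset_def filter_mset_replicate_mset)
qed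

text \<open>The multiples of 1 nearest to \<open>l\<close> are 0 and 1. At \<open>l = 1\<close>
  floor and ceiling coincide, hence the case split.\<close>

lemma abs_diff_nim_1:
  assumes "0 < l" "l \<le> 1"
  shows "\<bar>l - nim 1 l\<bar> = min l (1 - l)"
proof (cases "l = 1")
  case False
  then have "\<lfloor>l\<rfloor> = 0" "\<lceil>l\<rceil> = 1"
    using assms by (auto simp: floor_eq_iff ceiling_eq_iff)
  then show ?thesis
    using assms by (auto simp: nim_def)
qed (simp add: nim_def)

text \<open>Contribution of one distinct eigenvalue, multiplicity included; the sign sits at the
  logarithm so that terms are nonnegative on \<open>{0<..1}\<close>.\<close>

definition M_term :: "complex ^ ('a::finite \<times> 'b::finite) \<Rightarrow> real \<Rightarrow> real" where
  "M_term v l = real (vec.dim (eigenspace (trace_B (ket_bra v)) (of_real l)))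
    * (min l (1 - l) * - log 2 l)"

lemma M_A_ket_bra:
  assumes v: "norm v = 1"
  shows "M_A (ket_bra v) = (\<Sum>l\<in>eigenvalues (trace_B (ket_bra v)) - {0}. M_term v l)"
proof -
  have z: "trace_B (spectral_part (ket_bra v) 0) = 0"
    by (simp add: spectral_part_def trace_B_def vec_eq_iff)
  have "M_A (ket_bra v) = - (\<Sum>l\<in>#{#l \<in># eigenvalue_mset (trace_B (ket_bra v)). l \<noteq> 0#}.
       \<bar>l - nim 1 l\<bar> * log 2 l)"
    \<comment> \<open>Only \<eta> = 1 survives, with a one-dimensional eigenspace, so the
      denominator in the logarithm is 1.\<close>
    unfolding M_A_def
    by (subst sum_eigenvalues_ket_bra[OF v])
      (simp_all add: z nonzero_eigenvalues_0 spectral_part_ket_bra[OF v] dim_eigenspace_ket_bra[OF v])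
  also have "\<dots> = (\<Sum>l\<in>eigenvalues (trace_B (ket_bra v)) - {0}. M_term v l)"
    unfolding sum_eigenvalue_mset_nonzero[OF hermitian_reduced] sum_negf[symmetric]
  proof (rule sum.cong)
    fix l assume "l \<in> eigenvalues (trace_B (ket_bra v)) - {0}"
    then have "0 < l" "l \<le> 1"
      using eigenvalues_reduced_nonneg[of l v] eigenvalues_reduced_le[of l v] v by auto
    then show "- (real (vec.dim (eigenspace (trace_B (ket_bra v)) (of_real l)))
        * (\<bar>l - nim 1 l\<bar> * log 2 l)) = M_term v l"
      by (simp add: M_term_def abs_diff_nim_1)
  qed simp
  finally show ?thesis .
qed

lemma M_B_ket_bra:
  assumes v: "norm v = 1"
  shows "M_B (ket_bra v) = M_A (ket_bra (swap_vec v))"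
proof -
  have w: "norm (swap_vec v) = 1"
    using v by simp
  have z: "trace_A (spectral_part (ket_bra v) 0) = 0"
      "trace_B (spectral_part (ket_bra (swap_vec v)) 0) = 0"
    by (simp_all add: spectral_part_def trace_A_def trace_B_def vec_eq_iff)
  show ?thesis
    unfolding M_A_def M_B_def
    by (subst sum_eigenvalues_ket_bra[OF v], simp add: z nonzero_eigenvalues_0,
        subst sum_eigenvalues_ket_bra[OF w])
      (simp_all add: z nonzero_eigenvalues_0 spectral_part_ket_bra[OF v] dim_eigenspace_ket_bra[OF v]
        spectral_part_ket_bra[OF w] dim_eigenspace_ket_bra[OF w] trace_A_ket_bra)
qed

lemma M_B_eq_M_A:
  assumes "norm v = 1"
  shows "M_B (ket_bra v) = M_A (ket_bra v)"
  using assms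
  by (simp add: M_B_ket_bra M_A_ket_bra eigenvalues_swap M_term_def dim_eigenspace_swap)

lemma M_AB_ket_bra:
  assumes "norm v = 1"
  shows "M_AB (ket_bra v) = (\<Sum>l\<in>eigenvalues (trace_B (ket_bra v)) - {0}. M_term v l)"
  using assms by (simp add: M_AB_def M_B_eq_M_A M_A_ket_bra)

section \<open>Vanishing, entropy bound and equality case\<close>

lemma M_AB_ket_bra_eq_0_iff:
  assumes v: "norm v = 1"
  shows "M_AB (ket_bra v) = 0 \<longleftrightarrow> product_vec v"
proof
  let ?E = "eigenvalues (trace_B (ket_bra v))"
  assume M: "M_AB (ket_bra v) = 0"
  have bounds: "0 < l" "l \<le> 1" if "l \<in> ?E - {0}" for l
    using that eigenvalues_reduced_nonneg[of l v] eigenvalues_reduced_le[of l v] v by auto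
  have nonneg: "0 \<le> M_term v l" if "l \<in> ?E - {0}" for l
    using bounds[OF that] unfolding M_term_def by (intro mult_nonneg_nonneg) simp_all
  have zero: "M_term v l = 0" if "l \<in> ?E - {0}" for l
    using sum_nonneg_eq_0_iff[of "?E - {0}" "M_term v"] that nonneg M
      finite_eigenvalues[OF hermitian_reduced[of v]] by (simp add: M_AB_ket_bra[OF v])
  have "v \<noteq> 0"
    using v by auto
  then obtain l where l: "l \<in> ?E - {0}"
    using reduced_nonzero_eigenvalue by blast
  have "vec.dim (eigenspace (trace_B (ket_bra v)) (of_real l)) \<noteq> 0"
    using l eigenvalue_iff_dim by (metis DiffD1 less_irrefl)
  with zero[OF l] have "min l (1 - l) = 0 \<or> log 2 l = 0"
    unfolding M_term_def by (metis mult_eq_0_iff neg_equal_0_iff_equal of_nat_eq_0_iff)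
  \<comment> \<open>For \<open>l\<close> in \<open>{0<..1}\<close> either factor vanishes only at
    1.\<close>
  then have "l = 1"
    using bounds[OF l] by (auto simp: min_def log_def split: if_splits)
  then show "product_vec v"
    using l v product_vec_if_eigenvalue_1 by auto
next
  assume "product_vec v"
  then obtain a b where ab: "v = tensor_vec a b"
    by (auto simp: product_vec_def)
  have "l = 1" if "l \<in> eigenvalues (trace_B (ket_bra v)) - {0}" for l
    using eigenvalues_reduced_product[of a b l] that v ab by auto
  moreover have "M_term v 1 = 0"
    by (simp add: M_term_def)
  ultimately show "M_AB (ket_bra v) = 0"
    unfolding M_AB_ket_bra[OF v] by (metis (no_types, lifting) sum.neutral)
qed

lemma M_AB_ket_bra_le:
  assumes v: "norm v = 1"
  shows "M_AB (ket_bra v) \<le> von_neumann_entropy (trace_B (ket_bra v))"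
  unfolding M_AB_ket_bra[OF v] von_neumann_entropy_eq[OF hermitian_reduced] sum_negf[symmetric]
proof (rule sum_mono)
  fix l assume "l \<in> eigenvalues (trace_B (ket_bra v)) - {0}"
  then have "0 < l" "l \<le> 1"
    using eigenvalues_reduced_nonneg[of l v] eigenvalues_reduced_le[of l v] v by auto
  \<comment> \<open>The factor \<open>- log 2 l\<close> is nonnegative because
    \<open>l \<le> 1\<close>.\<close>
  then have "min l (1 - l) * - log 2 l \<le> l * - log 2 l"
    by (intro mult_right_mono) auto
  then show "M_term v l
      \<le> - (real (vec.dim (eigenspace (trace_B (ket_bra v)) (of_real l))) * (l * log 2 l))"
    using mult_left_mono[of "min l (1 - l) * - log 2 l" "l * - log 2 l"
        "real (vec.dim (eigenspace (trace_B (ket_bra v)) (of_real l)))"]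
    by (simp add: M_term_def)
qed

lemma M_AB_ket_bra_eq:
  assumes v: "norm v = 1" and s: "\<forall>s\<in>schmidt_coefficients v. s \<le> 1 / sqrt 2"
  shows "M_AB (ket_bra v) = von_neumann_entropy (trace_B (ket_bra v))"
  unfolding M_AB_ket_bra[OF v] von_neumann_entropy_eq[OF hermitian_reduced] sum_negf[symmetric]
proof (rule sum.cong)
  fix l assume "l \<in> eigenvalues (trace_B (ket_bra v)) - {0}"
  then have "sqrt l \<le> sqrt (1 / 2)"
    using s by (auto simp: schmidt_coefficients_def real_sqrt_divide)
  \<comment> \<open>The Schmidt bound squares to \<open>l \<le> 1 / 2\<close>, so 0 is a nearest
    integer to \<open>l\<close>.\<close>
  then have "min l (1 - l) = l"
    by simp
  then show "M_term v l
      = - (real (vec.dim (eigenspace (trace_B (ket_bra v)) (of_real l))) * (l * log 2 l))"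
    by (simp add: M_term_def)
qed simp

theorem proposition5:
  fixes \<phi> :: "complex ^ ('a::finite \<times> 'b::finite)"
  assumes "norm \<phi> = 1"
  shows "(M_AB (ket_bra \<phi>) = 0 \<longleftrightarrow> product_vec \<phi>)
    \<and> (\<not> product_vec \<phi> \<longrightarrow> M_AB (ket_bra \<phi>) \<noteq> 0)
    \<and> M_AB (ket_bra \<phi>) \<le> von_neumann_entropy (trace_B (ket_bra \<phi>))
    \<and> ((\<forall>s \<in> schmidt_coefficients \<phi>. s \<le> 1 / sqrt 2)
        \<longrightarrow> M_AB (ket_bra \<phi>) = von_neumann_entropy (trace_B (ket_bra \<phi>)))"
  using assms M_AB_ket_bra_eq_0_iff M_AB_ket_bra_le M_AB_ket_bra_eq by blast

end
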